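(* There is a polynomial-time algorithm that, given a binary house allocation instance $\langle N,H,V\rangle$, computes an envy-free allocation whose size is maximum among all envy-free allocations.
   Context: A house allocation instance $\langle N,H,V\rangle$ consists of a finite set $N$ of $n$ agents, a finite set $H$ of $m$ houses, and for each agent $i\in N$ a valuation $v_i:H\to\mathbb{R}_{\ge 0}$, with the convention $v_i(\emptyset)=0$. The instance is binary if $v_i(h)\in\{0,1\}$ for all $i,h$. An allocation $A$ assigns to each agent $i$ either one house $A(i)\in H$ or nothing ($A(i)=\emptyset$), with each house assigned to at most one agent; an agent may be assigned a house it values at zero, and houses may remain unassigned. The size $|A|$ is the number of agents that are assigned a house. An allocation $A$ is envy-free if $v_i(A(i))\ge v_i(A(j))$ for all $i,j\in N$. *)

theory Defs
  imports Complex_Main "HOL-Computational_Algebra.Polynomial"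
begin

section \<open>House allocation\<close>

definition house_instance :: "'a set \<Rightarrow> 'h set \<Rightarrow> ('a \<Rightarrow> 'h \<Rightarrow> real) \<Rightarrow> bool" where
  "house_instance N H v \<longleftrightarrow> finite N \<and> finite H \<and> (\<forall>i\<in>N. \<forall>h\<in>H. v i h \<ge> 0)"

definition binary_instance :: "'a set \<Rightarrow> 'h set \<Rightarrow> ('a \<Rightarrow> 'h \<Rightarrow> real) \<Rightarrow> bool" where
  "binary_instance N H v \<longleftrightarrow> house_instance N H v \<and> (\<forall>i\<in>N. \<forall>h\<in>H. v i h \<in> {0, 1})"

text \<open>An allocation is a partial map; \<open>None\<close> plays the role of the empty assignment.\<close>

definition allocation :: "'a set \<Rightarrow> 'h set \<Rightarrow> ('a \<rightharpoonup> 'h) \<Rightarrow> bool" where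
  "allocation N H A \<longleftrightarrow> dom A \<subseteq> N \<and> ran A \<subseteq> H \<and> inj_on A (dom A)"

definition alloc_size :: "('a \<rightharpoonup> 'h) \<Rightarrow> nat" where
  "alloc_size A = card (dom A)"

definition bundle_value :: "('h \<Rightarrow> real) \<Rightarrow> 'h option \<Rightarrow> real" where
  "bundle_value w b = (case b of None \<Rightarrow> 0 | Some h \<Rightarrow> w h)"

definition envy_free :: "'a set \<Rightarrow> ('a \<Rightarrow> 'h \<Rightarrow> real) \<Rightarrow> ('a \<rightharpoonup> 'h) \<Rightarrow> bool" where
  "envy_free N v A \<longleftrightarrow> (\<forall>i\<in>N. \<forall>j\<in>N. bundle_value (v i) (A i) \<ge> bundle_value (v i) (A j))"

definition max_size_envy_free ::
    "'a set \<Rightarrow> 'h set \<Rightarrow> ('a \<Rightarrow> 'h \<Rightarrow> real) \<Rightarrow> ('a \<rightharpoonup> 'h) \<Rightarrow> bool" where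
  "max_size_envy_free N H v A \<longleftrightarrow>
     allocation N H A \<and> envy_free N v A \<and>
     (\<forall>B. allocation N H B \<and> envy_free N v B \<longrightarrow> alloc_size B \<le> alloc_size A)"

section \<open>Model of computation\<close>

text \<open>
  A random access machine, presented as a while language. The memory is a family of arrays of
  natural numbers; a program mentions only finitely many of them, and a scalar is cell 0 of an
  array. The arithmetic consists of addition and truncated subtraction, each operation at unit
  cost. Multiplication is deliberately absent: without it, the bit length of the largest
  number in memory grows by at most a constant per unit of time, so polynomial time on this
  machine agrees with polynomial time on Turing machines.
\<close>

type_synonym vname = string
type_synonym state = "vname \<Rightarrow> nat \<Rightarrow> nat"

datatype aexp = Num nat | Read vname aexp | Add aexp aexp | Sub aexp aexp

datatype bexp = Less aexp aexp | Neg bexp | Conj bexp bexp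

datatype com =
    Skip
  | Write vname aexp aexp
  | Seq com com
  | If bexp com com
  | While bexp com

primrec aval :: "aexp \<Rightarrow> state \<Rightarrow> nat" where
  "aval (Num k) s = k"
| "aval (Read x e) s = s x (aval e s)"
| "aval (Add e f) s = aval e s + aval f s"
| "aval (Sub e f) s = aval e s - aval f s"

primrec bval :: "bexp \<Rightarrow> state \<Rightarrow> bool" where
  "bval (Less e f) s \<longleftrightarrow> aval e s < aval f s"
| "bval (Neg b) s \<longleftrightarrow> \<not> bval b s"
| "bval (Conj b c) s \<longleftrightarrow> bval b s \<and> bval c s"

primrec acost :: "aexp \<Rightarrow> nat" where
  "acost (Num k) = 1"
| "acost (Read x e) = acost e + 1"
| "acost (Add e f) = acost e + acost f + 1"
| "acost (Sub e f) = acost e + acost f + 1"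

primrec bcost :: "bexp \<Rightarrow> nat" where
  "bcost (Less e f) = acost e + acost f + 1"
| "bcost (Neg b) = bcost b + 1"
| "bcost (Conj b c) = bcost b + bcost c + 1"

text \<open>\<open>exec c s t s'\<close>: started in \<open>s\<close>, the program \<open>c\<close> halts in \<open>s'\<close> after time \<open>t\<close>.\<close>

inductive exec :: "com \<Rightarrow> state \<Rightarrow> nat \<Rightarrow> state \<Rightarrow> bool" where
  Skip: "exec Skip s 1 s"
| Write: "exec (Write x e f) s (acost e + acost f + 1) (s(x := (s x)(aval e s := aval f s)))"
| Seq: "exec c s t s' \<Longrightarrow> exec d s' u s'' \<Longrightarrow> exec (Seq c d) s (t + u) s''"
| IfTrue: "bval b s \<Longrightarrow> exec c s t s' \<Longrightarrow> exec (If b c d) s (bcost b + t) s'"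
| IfFalse: "\<not> bval b s \<Longrightarrow> exec d s t s' \<Longrightarrow> exec (If b c d) s (bcost b + t) s'"
| WhileFalse: "\<not> bval b s \<Longrightarrow> exec (While b c) s (bcost b) s"
| WhileTrue: "bval b s \<Longrightarrow> exec c s t s' \<Longrightarrow> exec (While b c) s' u s'' \<Longrightarrow>
    exec (While b c) s (bcost b + t + u) s''"

lemma exec_deterministic:
  "exec c s t s' \<Longrightarrow> exec c s u s'' \<Longrightarrow> u = t \<and> s'' = s'"
proof (induction arbitrary: u s'' rule: exec.induct)
  case (Skip s)
  then show ?case by (auto elim: exec.cases)
next
  case (Write x e f s)
  then show ?case by (auto elim: exec.cases)
next
  case (Seq c s t s' d u s'' w r)
  from Seq.prems show ?case by cases (use Seq.IH in blast)+
next
  case (IfTrue b s c t s' d)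
  from IfTrue.prems show ?case by cases (use IfTrue in blast)+
next
  case (IfFalse b s d t s' c)
  from IfFalse.prems show ?case by cases (use IfFalse in blast)+
next
  case (WhileFalse b s c)
  from WhileFalse.prems show ?case by cases (use WhileFalse in blast)+
next
  case (WhileTrue b s c t s' u s'')
  from WhileTrue.prems show ?case by cases (use WhileTrue in blast)+
qed

section \<open>Input and output\<close>

text \<open>
  The agents are numbered \<open>0, \<dots>, n - 1\<close> and the houses \<open>0, \<dots>, m - 1\<close>. The machine is given
  \<open>n\<close>, \<open>m\<close> and the binary valuation matrix, stored row by row; all other memory cells are zero.
\<close>

definition input_state :: "nat \<Rightarrow> nat \<Rightarrow> (nat \<Rightarrow> nat \<Rightarrow> real) \<Rightarrow> state" where
  "input_state n m v = (\<lambda>x k.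
     if x = ''n'' \<and> k = 0 then n
     else if x = ''m'' \<and> k = 0 then m
     else if x = ''v'' \<and> k < n * m \<and> v (k div m) (k mod m) = 1 then 1
     else 0)"

text \<open>Cell \<open>i\<close> of the output array holds \<open>0\<close> if agent \<open>i\<close> gets nothing, and \<open>h + 1\<close> for house \<open>h\<close>.\<close>

definition output_alloc :: "nat \<Rightarrow> state \<Rightarrow> (nat \<rightharpoonup> nat)" where
  "output_alloc n s = (\<lambda>i. if i < n \<and> s ''a'' i > 0 then Some (s ''a'' i - 1) else None)"

end

theory Submission
  imports Defs
begin

text \<open>
  Call a set \<open>S\<close> of houses saturated if the agents who like some house in \<open>S\<close> can all be matched
  to houses in \<open>S\<close> that they like. The houses used by an envy-free allocation form a saturated
  set. An auction finds a saturated set that contains every other one: an unmatched agent takes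
  the liked house with the smallest label, evicts the owner and increments the label; a house
  whose label reaches \<open>m + 2\<close> is withdrawn, and a gap in the labels shows that no saturated set
  contains it. When no unmatched agent likes a remaining house, the unmatched agents receive
  arbitrary free houses that remain. Either all agents or all remaining houses are then assigned.
\<close>

section \<open>Timed execution\<close>

text \<open>By determinism the existential speaks of the only run, so \<open>runs\<close> is a
  total-correctness assertion with time budget \<open>T\<close>. The rules for \<open>Write\<close>
  and \<open>If\<close> pass on the unspent budget, so that the simplifier evaluates straight-line
  code.\<close>

definition runs :: "com \<Rightarrow> state \<Rightarrow> nat \<Rightarrow> (state \<Rightarrow> bool) \<Rightarrow> bool" where
  "runs c s T Q \<longleftrightarrow> (\<exists>t s'. exec c s t s' \<and> t \<le> T \<and> Q s')"

inductive_cases exec_WriteE: "exec (Write x e f) s t s'"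
inductive_cases exec_SeqE: "exec (Seq c d) s t s'"
inductive_cases exec_IfE: "exec (If b c d) s t s'"

lemma runs_Write [simp]:
  "runs (Write x e f) s T Q \<longleftrightarrow>
     acost e + acost f + 1 \<le> T \<and> Q (s(x := (s x)(aval e s := aval f s)))"
  unfolding runs_def by (metis exec.Write exec_WriteE)

lemma runs_Seq_Write [simp]:
  "runs (Seq (Write x e f) d) s T Q \<longleftrightarrow>
     acost e + acost f + 1 \<le> T \<and>
     runs d (s(x := (s x)(aval e s := aval f s))) (T - (acost e + acost f + 1)) Q"
proof
  assume "runs (Seq (Write x e f) d) s T Q"
  then show "acost e + acost f + 1 \<le> T \<and>
     runs d (s(x := (s x)(aval e s := aval f s))) (T - (acost e + acost f + 1)) Q"
    unfolding runs_def by (fastforce elim!: exec_SeqE exec_WriteE)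
next
  assume *: "acost e + acost f + 1 \<le> T \<and>
     runs d (s(x := (s x)(aval e s := aval f s))) (T - (acost e + acost f + 1)) Q"
  then obtain t s' where t: "exec d (s(x := (s x)(aval e s := aval f s))) t s'"
    "t \<le> T - (acost e + acost f + 1)" "Q s'"
    unfolding runs_def by blast
  have "exec (Seq (Write x e f) d) s (acost e + acost f + 1 + t) s'"
    by (rule exec.Seq[OF exec.Write t(1)])
  moreover have "acost e + acost f + 1 + t \<le> T" using * t(2) by linarith
  ultimately show "runs (Seq (Write x e f) d) s T Q"
    unfolding runs_def using t(3) by blast
qed

lemma runs_If [simp]:
  "runs (If b c d) s T Q \<longleftrightarrow>
     bcost b \<le> T \<and> (if bval b s then runs c s (T - bcost b) Q else runs d s (T - bcost b) Q)"
proof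
  assume "runs (If b c d) s T Q"
  then show "bcost b \<le> T \<and> (if bval b s then runs c s (T - bcost b) Q else runs d s (T - bcost b) Q)"
    unfolding runs_def by (fastforce elim!: exec_IfE)
next
  assume *: "bcost b \<le> T \<and>
    (if bval b s then runs c s (T - bcost b) Q else runs d s (T - bcost b) Q)"
  then obtain t s' where t: "exec (if bval b s then c else d) s t s'" "t \<le> T - bcost b" "Q s'"
    unfolding runs_def by (cases "bval b s") auto
  then have "exec (If b c d) s (bcost b + t) s'"
    by (cases "bval b s") (auto intro: exec.IfTrue exec.IfFalse)
  moreover have "bcost b + t \<le> T" using * t(2) by linarith
  ultimately show "runs (If b c d) s T Q" unfolding runs_def using t(3) by blast
qed

lemma runs_Seq:
  assumes "runs c s T1 R" "\<And>s'. R s' \<Longrightarrow> runs d s' T2 Q"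
  shows "runs (Seq c d) s (T1 + T2) Q"
  using assms unfolding runs_def by (meson add_mono exec.Seq)

lemma runs_mono:
  assumes "runs c s T Q" "T \<le> T'" "\<And>s'. Q s' \<Longrightarrow> Q' s'"
  shows "runs c s T' Q'"
  using assms unfolding runs_def by (meson le_trans)

text \<open>Each iteration costs at most \<open>bcost b + T\<close> and lowers the variant, so there
  are at most \<open>\<mu> s\<close> of them; the last summand pays for the failing test.\<close>

lemma runs_While:
  fixes \<mu> :: "state \<Rightarrow> nat"
  assumes "I s"
    and body: "\<And>s. I s \<Longrightarrow> bval b s \<Longrightarrow> runs c s T (\<lambda>s'. I s' \<and> \<mu> s' < \<mu> s)"
  shows "runs (While b c) s ((bcost b + T) * \<mu> s + bcost b) (\<lambda>s'. I s' \<and> \<not> bval b s')"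
  using assms(1)
proof (induction "\<mu> s" arbitrary: s rule: less_induct)
  case less
  show ?case
  proof (cases "bval b s")
    case False
    then show ?thesis unfolding runs_def using exec.WhileFalse[OF False] less.prems
      by (meson le_add2)
  next
    case True
    obtain t s' where s': "exec c s t s'" "t \<le> T" "I s'" "\<mu> s' < \<mu> s"
      using body[OF less.prems True] unfolding runs_def by blast
    obtain u s'' where s'': "exec (While b c) s' u s''"
      "u \<le> (bcost b + T) * \<mu> s' + bcost b" "I s'' \<and> \<not> bval b s''"
      using less.hyps[OF s'(4,3)] unfolding runs_def by blast
    have "(bcost b + T) * Suc (\<mu> s') \<le> (bcost b + T) * \<mu> s"
      using s'(4) by (intro mult_le_mono2) simp
    then have "bcost b + t + u \<le> (bcost b + T) * \<mu> s + bcost b"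
      using s'(2) s''(2) by simp
    then show ?thesis
      unfolding runs_def using exec.WhileTrue[OF True s'(1) s''(1)] s''(3) by blast
  qed
qed

section \<open>The program\<close>

abbreviation Scalar :: "vname \<Rightarrow> aexp" where "Scalar x \<equiv> Read x (Num 0)"

abbreviation Assign :: "vname \<Rightarrow> aexp \<Rightarrow> com" where "Assign x e \<equiv> Write x (Num 0) e"

text \<open>The comparison with \<open>d\<close> is strict and \<open>d\<close> starts at
  \<open>m + 2\<close>, so withdrawn houses are never selected.\<close>

definition inspect_house :: com where
  "inspect_house =
     If (Conj (Less (Num 0) (Read ''v'' (Add (Scalar ''o'') (Scalar ''h''))))
              (Less (Read ''l'' (Scalar ''h'')) (Scalar ''d'')))
      (Seq (Assign ''b'' (Scalar ''h''))
      (Seq (Assign ''d'' (Read ''l'' (Scalar ''h'')))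
           (Assign ''h'' (Add (Scalar ''h'') (Num 1)))))
      (Assign ''h'' (Add (Scalar ''h'') (Num 1)))"

definition cheapest_house :: com where
  "cheapest_house =
     Seq (Assign ''d'' (Add (Scalar ''m'') (Num 2)))
    (Seq (Assign ''h'' (Num 0))
    (While (Less (Scalar ''h'') (Scalar ''m'')) inspect_house))"

text \<open>Arrays: labels \<open>l\<close>, owners \<open>w\<close>. The scalars \<open>b\<close> and \<open>d\<close> hold the house found by
  \<open>cheapest_house\<close> and its label (\<open>d = m + 2\<close> if there is none); \<open>o\<close> holds \<open>i * m\<close>, the start of
  row \<open>i\<close>. The owner \<open>i\<close> of a house is stored as \<open>n - i\<close>, so that the initial \<open>0\<close> of a house without
  owner points to the unused cell \<open>n\<close> of the output array.\<close>

definition bid :: com where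
  "bid =
     Seq (Write ''a'' (Sub (Scalar ''n'') (Read ''w'' (Scalar ''b''))) (Num 0))
    (Seq (Write ''l'' (Scalar ''b'') (Add (Scalar ''d'') (Num 1)))
    (Seq (Assign ''o'' (Num 0))
    (If (Less (Scalar ''d'') (Add (Scalar ''m'') (Num 1)))
      (Seq (Write ''a'' (Scalar ''i'') (Add (Scalar ''b'') (Num 1)))
      (Seq (Write ''w'' (Scalar ''b'') (Sub (Scalar ''n'') (Scalar ''i'')))
           (Assign ''i'' (Num 0))))
      (Assign ''i'' (Num 0)))))"

text \<open>A bid sends the scan back to agent \<open>0\<close>, since the evicted agent may precede
  \<open>i\<close>. Adding \<open>m\<close> to \<open>o\<close> at each advance stands in for the
  product \<open>i * m\<close>, as the machine does not multiply.\<close>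

definition serve_agent :: com where
  "serve_agent =
     Seq cheapest_house
      (If (Conj (Less (Scalar ''d'') (Add (Scalar ''m'') (Num 2)))
                (Neg (Less (Num 0) (Read ''a'' (Scalar ''i'')))))
        bid
        (Seq (Assign ''i'' (Add (Scalar ''i'') (Num 1)))
             (Assign ''o'' (Add (Scalar ''o'') (Scalar ''m'')))))"

definition auction :: com where
  "auction = While (Less (Scalar ''i'') (Scalar ''n'')) serve_agent"

text \<open>After the auction, label \<open>0\<close> marks exactly the houses that are neither
  owned nor withdrawn.\<close>

definition fill_step :: com where
  "fill_step =
     If (Less (Num 0) (Read ''a'' (Scalar ''i'')))
      (Assign ''i'' (Add (Scalar ''i'') (Num 1)))
    (If (Less (Num 0) (Read ''l'' (Scalar ''h'')))
      (Assign ''h'' (Add (Scalar ''h'') (Num 1)))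
      (Seq (Write ''a'' (Scalar ''i'') (Add (Scalar ''h'') (Num 1)))
      (Seq (Assign ''i'' (Add (Scalar ''i'') (Num 1)))
           (Assign ''h'' (Add (Scalar ''h'') (Num 1))))))"

definition fill :: com where
  "fill =
     Seq (Assign ''i'' (Num 0))
    (Seq (Assign ''h'' (Num 0))
    (While (Conj (Less (Scalar ''i'') (Scalar ''n'')) (Less (Scalar ''h'') (Scalar ''m''))) fill_step))"

section \<open>The auction invariant\<close>

locale binary_houses =
  fixes n m :: nat and v :: "nat \<Rightarrow> nat \<Rightarrow> real"
  assumes binary: "binary_instance {..<n} {..<m} v"
begin

definition likes :: "nat \<Rightarrow> nat \<Rightarrow> bool" where
  "likes i h \<longleftrightarrow> i < n \<and> h < m \<and> v i h = 1"

definition saturated :: "nat set \<Rightarrow> bool" where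
  "saturated S \<longleftrightarrow> S \<subseteq> {..<m} \<and>
     (\<exists>f. inj_on f {i. \<exists>h\<in>S. likes i h} \<and> (\<forall>i. (\<exists>h\<in>S. likes i h) \<longrightarrow> f i \<in> S \<and> likes i (f i)))"

text \<open>The bound \<open>l h \<le> l h' + 1\<close> is an approximate complementary slackness:
  an owner took a house of smallest label among those it likes, and labels never fall. The clause on
  \<open>w\<close> makes owners unique. The last clause says that withdrawing a house, at label
  \<open>m + 2\<close>, loses nothing.\<close>

definition auction_inv :: "(nat \<Rightarrow> nat) \<Rightarrow> (nat \<Rightarrow> nat) \<Rightarrow> (nat \<Rightarrow> nat) \<Rightarrow> bool" where
  "auction_inv a l w \<longleftrightarrow>
     (\<forall>i h. i < n \<longrightarrow> a i = Suc h \<longrightarrow>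
        likes i h \<and> 0 < l h \<and> l h \<le> m + 1 \<and> w h = n - i \<and> (\<forall>h'. likes i h' \<longrightarrow> l h \<le> l h' + 1)) \<and>
     (\<forall>h<m. l h \<le> m + 2 \<and> (l h = 0 \<longrightarrow> w h = 0) \<and>
        (0 < l h \<and> l h \<le> m + 1 \<longrightarrow> (\<exists>i<n. a i = Suc h))) \<and>
     (\<forall>S h. saturated S \<longrightarrow> h \<in> S \<longrightarrow> l h \<le> m + 1)"

lemma auction_invD:
  assumes "auction_inv a l w" "i < n" "a i = Suc h"
  shows "likes i h" "0 < l h" "l h \<le> m + 1" "w h = n - i"
    "\<And>h'. likes i h' \<Longrightarrow> l h \<le> l h' + 1"
  using assms unfolding auction_inv_def by blast+

lemma auction_inv_houseD:
  assumes "auction_inv a l w" "h < m"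
  shows "l h \<le> m + 2" "l h = 0 \<Longrightarrow> w h = 0"
    "0 < l h \<Longrightarrow> l h \<le> m + 1 \<Longrightarrow> \<exists>i<n. a i = Suc h"
  using assms unfolding auction_inv_def by blast+

lemma auction_inv_saturated:
  assumes "auction_inv a l w" "saturated S" "h \<in> S"
  shows "l h \<le> m + 1"
  using assms unfolding auction_inv_def by blast

text \<open>Some label \<open>c\<close> with \<open>1 \<le> c \<le> m\<close> is not taken. The houses labelled above \<open>c\<close> contain all
  houses of \<open>S\<close> liked by their owners or by \<open>i\<close>; if \<open>i\<close> liked a house of \<open>S\<close>, those agents would
  outnumber the houses.\<close>

lemma not_saturated_if_label_max:
  assumes inv: "auction_inv a l w" and i: "a i = 0" "likes i b"
    and lb: "\<And>h. likes i h \<Longrightarrow> m + 1 \<le> l h"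
    and S: "saturated S"
  shows "b \<notin> S"
proof
  assume bS: "b \<in> S"
  have "i < n" "b < m" using i(2) by (auto simp: likes_def)
  \<comment> \<open>Only \<open>m - 1\<close> houses differ from \<open>b\<close>, so they miss one
    of the \<open>m\<close> labels from \<open>1\<close> to \<open>m\<close>; the label of
    \<open>b\<close> is at least \<open>m + 1\<close>.\<close>
  have "card (l ` ({..<m} - {b})) \<le> card ({..<m} - {b})" by (rule card_image_le) simp
  also have "\<dots> < card {1..m}" using \<open>b < m\<close> by simp
  finally have "\<not> {1..m} \<subseteq> l ` ({..<m} - {b})"
    by (meson card_mono finite_Diff finite_imageI finite_lessThan not_le)
  then obtain c where c: "1 \<le> c" "c \<le> m" "c \<notin> l ` ({..<m} - {b})"
    by (meson atLeastAtMost_iff subsetI)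
  have gap: "l h \<noteq> c" if "h < m" for h
    using that c lb[OF i(2)] by (cases "h = b") auto
  obtain f where f: "inj_on f {i. \<exists>h\<in>S. likes i h}"
    "\<And>i h. h \<in> S \<Longrightarrow> likes i h \<Longrightarrow> f i \<in> S \<and> likes i (f i)" and Sm: "S \<subseteq> {..<m}"
    using S unfolding saturated_def by blast
  define T where "T = {h \<in> S. c < l h}"
  define Z where "Z = {j. j < n \<and> (j = i \<or> (\<exists>h\<in>T. a j = Suc h)) \<and> (\<exists>h\<in>S. likes j h)}"
  have finZ: "finite Z" and finT: "finite T"
    using Sm unfolding Z_def T_def by (auto intro: finite_subset)
  \<comment> \<open>The house of an owner in \<open>Z\<close> is labelled at least
    \<open>c + 1\<close>, so every house this owner likes is labelled at least \<open>c\<close>, and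
    the gap excludes \<open>c\<close> itself.\<close>
  have ZT: "h \<in> T" if "j \<in> Z" "h \<in> S" "likes j h" for j h
  proof (cases "j = i")
    case True
    then show ?thesis using lb that c unfolding T_def by fastforce
  next
    case False
    then obtain h0 where h0: "h0 \<in> T" "a j = Suc h0" "j < n" using \<open>j \<in> Z\<close> unfolding Z_def by auto
    have "l h0 \<le> l h + 1" using auction_invD(5)[OF inv h0(3,2) that(3)] .
    moreover have "c < l h0" using h0 by (simp add: T_def)
    moreover have "l h \<noteq> c" using gap that Sm by blast
    ultimately show ?thesis using that by (simp add: T_def)
  qed
  \<comment> \<open>The matching of \<open>S\<close> injects \<open>Z\<close> into \<open>T\<close>,
    whereas choosing owners injects \<open>T\<close> into \<open>Z - {i}\<close>: a contradiction by
    counting.\<close>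
  have "card Z \<le> card T"
  proof (rule card_inj_on_le[where f = f])
    show "inj_on f Z" by (rule inj_on_subset[OF f(1)]) (auto simp: Z_def)
    show "f ` Z \<subseteq> T" using ZT f(2) unfolding Z_def by fastforce
  qed (fact finT)
  also have "card T \<le> card (Z - {i})"
  proof -
    \<comment> \<open>A house of \<open>T\<close> lies in a saturated set, so it is not withdrawn
      and its positive label gives it an owner.\<close>
    have "\<exists>j. j < n \<and> a j = Suc h" if "h \<in> T" for h
      using that auction_inv_houseD(3)[OF inv, of h] auction_inv_saturated[OF inv S, of h] Sm
      unfolding T_def by fastforce
    then obtain g where g: "\<And>h. h \<in> T \<Longrightarrow> g h < n \<and> a (g h) = Suc h" by metis
    have "inj_on g T" by (rule inj_onI) (metis g Suc_inject)
    moreover have "g ` T \<subseteq> Z - {i}"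
    proof
      fix j assume "j \<in> g ` T"
      then obtain h where h: "h \<in> T" "j = g h" by blast
      have "likes j h" using auction_invD(1)[OF inv] g h by blast
      then show "j \<in> Z - {i}" using g[OF h(1)] h i(1) unfolding Z_def T_def by auto
    qed
    ultimately show ?thesis by (rule card_inj_on_le) (simp add: finZ)
  qed
  also have "\<dots> < card Z"
    by (rule psubset_card_mono[OF finZ]) (use \<open>i < n\<close> bS i(2) in \<open>auto simp: Z_def\<close>)
  finally show False by simp
qed

text \<open>Raising the label of \<open>b\<close> only relaxes the bounds of the other owners, and
  the new owner meets its own bound because \<open>b\<close> had the smallest label among the houses
  it likes. At label \<open>m + 1\<close> nobody gets the house: its new label \<open>m + 2\<close>
  withdraws it.\<close>

lemma auction_inv_bid:
  assumes inv: "auction_inv a l w" and i: "a i = 0" "likes i b"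
    and min: "\<And>h. likes i h \<Longrightarrow> l b \<le> l h" and lb: "l b \<le> m + 1"
  shows "if l b < m + 1
    then auction_inv ((a(n - w b := 0))(i := Suc b)) (l(b := Suc (l b))) (w(b := n - i))
    else auction_inv (a(n - w b := 0)) (l(b := Suc (l b))) w"
proof -
  have "i < n" "b < m" using i(2) by (auto simp: likes_def)
  have evicted: "j = n - w b" if "j < n" "a j = Suc b" for j
    using auction_invD(4)[OF inv that] that by simp
  \<comment> \<open>If \<open>w b = 0\<close>, the cleared cell is \<open>n\<close>, which belongs
    to no agent. Otherwise \<open>b\<close> has a positive label, hence an owner, and the cleared
    cell is that of this owner.\<close>
  have kept: "j \<noteq> n - w b" if "j < n" "a j = Suc h" "h \<noteq> b" for j h
  proof
    assume j: "j = n - w b"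
    then have "w b \<noteq> 0" using that by auto
    then have "0 < l b" using auction_inv_houseD(2)[OF inv \<open>b < m\<close>] by auto
    then obtain k where k: "k < n" "a k = Suc b" using auction_inv_houseD(3)[OF inv \<open>b < m\<close> _ lb] by auto
    then show False using evicted[OF k] j that by simp
  qed
  have old: "likes j h \<and> 0 < l h \<and> l h \<le> m + 1 \<and> w h = n - j \<and> h \<noteq> b \<and>
      (\<forall>h'. likes j h' \<longrightarrow> l h \<le> (l(b := Suc (l b))) h' + 1)"
    if "j < n" "(a(n - w b := 0)) j = Suc h" for j h
  proof -
    have aj: "a j = Suc h" "j \<noteq> n - w b" using that(2) by (auto split: if_splits)
    then have "h \<noteq> b" using evicted that(1) by auto
    then show ?thesis using auction_invD[OF inv that(1) aj(1)]
      by (auto simp: le_SucI)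
  qed
  have owner: "\<exists>j<n. j \<noteq> i \<and> (a(n - w b := 0)) j = Suc h"
    if "h < m" "h \<noteq> b" "0 < l h" "l h \<le> m + 1" for h
    using auction_inv_houseD(3)[OF inv that(1,3,4)] kept that(2) i(1) by fastforce
  show ?thesis
  proof (cases "l b < m + 1")
    case True
    have "auction_inv ((a(n - w b := 0))(i := Suc b)) (l(b := Suc (l b))) (w(b := n - i))"
      unfolding auction_inv_def
    proof (intro conjI allI impI)
      fix j h assume "j < n" "((a(n - w b := 0))(i := Suc b)) j = Suc h"
      note jh = this
      have "likes j h \<and> 0 < (l(b := Suc (l b))) h \<and> (l(b := Suc (l b))) h \<le> m + 1 \<and>
        (w(b := n - i)) h = n - j \<and>
        (\<forall>h'. likes j h' \<longrightarrow> (l(b := Suc (l b))) h \<le> (l(b := Suc (l b))) h' + 1)"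
      proof (cases "j = i")
        case True
        then show ?thesis using jh i min \<open>l b < m + 1\<close> by (auto simp: le_SucI)
      next
        case False
        then show ?thesis using old[of j h] jh by auto
      qed
      then show "likes j h" "0 < (l(b := Suc (l b))) h" "(l(b := Suc (l b))) h \<le> m + 1"
        "(w(b := n - i)) h = n - j"
        "\<And>h'. likes j h' \<Longrightarrow> (l(b := Suc (l b))) h \<le> (l(b := Suc (l b))) h' + 1" by blast+
    next
      fix h assume "h < m"
      then show "(l(b := Suc (l b))) h \<le> m + 2"
        "(l(b := Suc (l b))) h = 0 \<Longrightarrow> (w(b := n - i)) h = 0"
        using auction_inv_houseD[OF inv, of h] lb by (auto split: if_splits)
      show "\<exists>j<n. ((a(n - w b := 0))(i := Suc b)) j = Suc h"
        if "0 < (l(b := Suc (l b))) h \<and> (l(b := Suc (l b))) h \<le> m + 1"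
      proof (cases "h = b")
        case True
        then show ?thesis using \<open>i < n\<close> by (intro exI[of _ i]) simp
      next
        case False
        then show ?thesis using owner[OF \<open>h < m\<close> False] that by fastforce
      qed
    next
      fix S h assume "saturated S" "h \<in> S"
      then show "(l(b := Suc (l b))) h \<le> m + 1"
        using auction_inv_saturated[OF inv] True by auto
    qed
    then show ?thesis using True by simp
  next
    case False
    then have lb': "l b = m + 1" using lb by simp
    have "auction_inv (a(n - w b := 0)) (l(b := Suc (l b))) w"
      unfolding auction_inv_def
    proof (intro conjI allI impI)
      fix j h assume "j < n" "(a(n - w b := 0)) j = Suc h"
      then show "likes j h" "0 < (l(b := Suc (l b))) h" "(l(b := Suc (l b))) h \<le> m + 1"
        "w h = n - j"
        "\<And>h'. likes j h' \<Longrightarrow> (l(b := Suc (l b))) h \<le> (l(b := Suc (l b))) h' + 1"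
        using old[of j h] by auto
    next
      fix h assume "h < m"
      then show "(l(b := Suc (l b))) h \<le> m + 2" "(l(b := Suc (l b))) h = 0 \<Longrightarrow> w h = 0"
        using auction_inv_houseD[OF inv, of h] lb by (auto split: if_splits)
      show "\<exists>j<n. (a(n - w b := 0)) j = Suc h"
        if "0 < (l(b := Suc (l b))) h \<and> (l(b := Suc (l b))) h \<le> m + 1"
      proof (cases "h = b")
        case True
        then show ?thesis using that lb' by auto
      next
        case False
        then show ?thesis using owner[OF \<open>h < m\<close> False] that by fastforce
      qed
    next
      fix S h assume "saturated S" "h \<in> S"
      \<comment> \<open>By minimality every house that \<open>i\<close> likes has label at least
        \<open>m + 1\<close>, so no saturated set contains \<open>b\<close>.\<close>
      moreover have "h \<noteq> b"
        using not_saturated_if_label_max[OF inv i _ \<open>saturated S\<close>] min lb' \<open>h \<in> S\<close> by auto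
      ultimately show "(l(b := Suc (l b))) h \<le> m + 1"
        using auction_inv_saturated[OF inv] by auto
    qed
    then show ?thesis using False by simp
  qed
qed

section \<open>Running the program\<close>

definition input_kept :: "state \<Rightarrow> bool" where
  "input_kept s \<longleftrightarrow> s ''n'' 0 = n \<and> s ''m'' 0 = m \<and>
     (\<forall>i<n. \<forall>h<m. 0 < s ''v'' (i * m + h) \<longleftrightarrow> likes i h)"

lemma input_kept_input_state: "input_kept (input_state n m v)"
proof -
  have "i * m + h < n * m" if "i < n" "h < m" for i h
  proof -
    have "i * m + h < Suc i * m" using that by simp
    also have "\<dots> \<le> n * m" using that by (intro mult_le_mono1) simp
    finally show ?thesis .
  qed
  then show ?thesis by (auto simp: input_kept_def input_state_def likes_def)
qed

text \<open>The loop invariant is the conclusion restricted to the houses below \<open>h\<close>. If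
  \<open>d\<close> ends at \<open>m + 2\<close>, then \<open>b\<close> may be left over from an
  earlier search, hence the guard on its properties.\<close>

lemma runs_cheapest_house:
  assumes kept: "input_kept s" and o: "s ''o'' 0 = i * m" and "i < n"
  shows "runs cheapest_house s (60 * m + 20)
    (\<lambda>s'. (\<forall>x. x \<notin> {''b'', ''d'', ''h''} \<longrightarrow> s' x = s x) \<and>
       (\<forall>h. likes i h \<longrightarrow> s' ''d'' 0 \<le> s ''l'' h \<or> m + 2 \<le> s ''l'' h) \<and>
       (s' ''d'' 0 < m + 2 \<longrightarrow> likes i (s' ''b'' 0) \<and> s ''l'' (s' ''b'' 0) = s' ''d'' 0) \<and>
       s' ''d'' 0 \<le> m + 2)"
proof -
  define I where "I = (\<lambda>s'. (\<forall>x. x \<notin> {''b'', ''d'', ''h''} \<longrightarrow> s' x = s x) \<and> s' ''h'' 0 \<le> m \<and>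
       (\<forall>h. h < s' ''h'' 0 \<longrightarrow> likes i h \<longrightarrow> s' ''d'' 0 \<le> s ''l'' h \<or> m + 2 \<le> s ''l'' h) \<and>
       (s' ''d'' 0 < m + 2 \<longrightarrow> likes i (s' ''b'' 0) \<and> s ''l'' (s' ''b'' 0) = s' ''d'' 0) \<and>
       s' ''d'' 0 \<le> m + 2)"
  have v: "0 < s ''v'' (i * m + h) \<longleftrightarrow> likes i h" if "h < m" for h
    using kept \<open>i < n\<close> that by (simp add: input_kept_def)
  have m: "s ''m'' 0 = m" using kept by (simp add: input_kept_def)
  let ?b = "Less (Scalar ''h'') (Scalar ''m'')"
  have loop: "runs (While ?b inspect_house) s' ((bcost ?b + 50) * (m - s' ''h'' 0) + bcost ?b)
      (\<lambda>s'. I s' \<and> \<not> bval ?b s')"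
    if "I s'" for s'
    using that
  proof (rule runs_While[where \<mu> = "\<lambda>s'. m - s' ''h'' 0"])
    fix s' assume I: "I s'" and "bval ?b s'"
    then have h: "s' ''h'' 0 < m" using m by (simp add: I_def)
    have eqs: "s' ''v'' = s ''v''" "s' ''l'' = s ''l''" "s' ''o'' = s ''o''"
      using I by (simp_all add: I_def)
    have I': "\<And>x. x \<notin> {''b'', ''d'', ''h''} \<Longrightarrow> s' x = s x"
      "\<And>h. h < s' ''h'' 0 \<Longrightarrow> likes i h \<Longrightarrow> s' ''d'' 0 \<le> s ''l'' h \<or> m + 2 \<le> s ''l'' h"
      "s' ''d'' 0 < m + 2 \<Longrightarrow> likes i (s' ''b'' 0) \<and> s ''l'' (s' ''b'' 0) = s' ''d'' 0"
      "s' ''d'' 0 \<le> m + 2"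
      using I unfolding I_def by blast+
    have skip: "I (s'(''h'' := (s' ''h'')(0 := Suc (s' ''h'' 0))))"
      if new: "\<not> (likes i (s' ''h'' 0) \<and> s ''l'' (s' ''h'' 0) < s' ''d'' 0)"
    proof -
      have "s' ''d'' 0 \<le> s ''l'' h \<or> m + 2 \<le> s ''l'' h" if "h < Suc (s' ''h'' 0)" "likes i h" for h
        using I'(2)[of h] new that by (cases "h = s' ''h'' 0") auto
      then show ?thesis using I' h unfolding I_def by simp
    qed
    have take: "I (s'(''b'' := (s' ''b'')(0 := s' ''h'' 0),
        ''d'' := (s' ''d'')(0 := s ''l'' (s' ''h'' 0)), ''h'' := (s' ''h'')(0 := Suc (s' ''h'' 0))))"
      if new: "likes i (s' ''h'' 0)" "s ''l'' (s' ''h'' 0) < s' ''d'' 0"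
    proof -
      have "s ''l'' (s' ''h'' 0) \<le> s ''l'' h \<or> m + 2 \<le> s ''l'' h"
        if "h < Suc (s' ''h'' 0)" "likes i h" for h
        using I'(2)[of h] new that by (cases "h = s' ''h'' 0") auto
      then show ?thesis using I' h new unfolding I_def by simp
    qed
    show "runs inspect_house s' 50 (\<lambda>s''. I s'' \<and> m - s'' ''h'' 0 < m - s' ''h'' 0)"
    proof (cases "likes i (s' ''h'' 0) \<and> s ''l'' (s' ''h'' 0) < s' ''d'' 0")
      case True
      then show ?thesis using diff_less_mono2[OF lessI h] take v[OF h] unfolding inspect_house_def by (simp add: eqs o)
    next
      case False
      then show ?thesis using diff_less_mono2[OF lessI h] skip v[OF h] unfolding inspect_house_def by (auto simp: eqs o)
    qed
  qed
  let ?s = "s(''d'' := (s ''d'')(0 := m + 2), ''h'' := (s ''h'')(0 := 0))"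
  have "I ?s" unfolding I_def by simp
  from loop[OF this]
  have "runs (While ?b inspect_house) ?s (55 * m + 5) (\<lambda>s'. I s' \<and> \<not> s' ''h'' 0 < s' ''m'' 0)"
    by (rule runs_mono) simp_all
  \<comment> \<open>The two initial assignments cost \<open>9\<close>, which leaves
    \<open>60 * m + 11\<close> of the budget.\<close>
  then have "runs (While ?b inspect_house) ?s (60 * m + 11)
    (\<lambda>s'. (\<forall>x. x \<notin> {''b'', ''d'', ''h''} \<longrightarrow> s' x = s x) \<and>
       (\<forall>h. likes i h \<longrightarrow> s' ''d'' 0 \<le> s ''l'' h \<or> m + 2 \<le> s ''l'' h) \<and>
       (s' ''d'' 0 < m + 2 \<longrightarrow> likes i (s' ''b'' 0) \<and> s ''l'' (s' ''b'' 0) = s' ''d'' 0) \<and>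
       s' ''d'' 0 \<le> m + 2)"
  proof (rule runs_mono)
    fix s' assume s': "I s' \<and> \<not> s' ''h'' 0 < s' ''m'' 0"
    then have "s' ''m'' = s ''m''" unfolding I_def by simp
    then have "s' ''h'' 0 = m" using s' m by (simp add: I_def)
    moreover have "h < m" if "likes i h" for h using that by (simp add: likes_def)
    ultimately show "(\<forall>x. x \<notin> {''b'', ''d'', ''h''} \<longrightarrow> s' x = s x) \<and>
       (\<forall>h. likes i h \<longrightarrow> s' ''d'' 0 \<le> s ''l'' h \<or> m + 2 \<le> s ''l'' h) \<and>
       (s' ''d'' 0 < m + 2 \<longrightarrow> likes i (s' ''b'' 0) \<and> s ''l'' (s' ''b'' 0) = s' ''d'' 0) \<and>
       s' ''d'' 0 \<le> m + 2"
      using s' unfolding I_def by metis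
  qed simp
  then show ?thesis
    unfolding cheapest_house_def by (simp add: m add.commute)
qed

section \<open>Termination and running time of the auction\<close>

definition slack :: "(nat \<Rightarrow> nat) \<Rightarrow> nat" where
  "slack l = (\<Sum>h<m. m + 2 - l h)"

lemma slack_bid:
  assumes "b < m" "l b \<le> m + 1"
  shows "slack (l(b := Suc (l b))) < slack l"
  unfolding slack_def by (rule sum_strict_mono_ex1) (use assms in auto)

definition settled :: "state \<Rightarrow> nat \<Rightarrow> bool" where
  "settled s j \<longleftrightarrow> 0 < s ''a'' j \<or> (\<forall>h. likes j h \<longrightarrow> m + 2 \<le> s ''l'' h)"

text \<open>The lexicographic pair of \<open>slack\<close> and \<open>n - i\<close>, encoded in base
  \<open>n + 1\<close>. The slack counts the label increments still possible: a bid uses up one and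
  resets \<open>i\<close>, and any other step advances \<open>i\<close>.\<close>

definition auction_time :: "state \<Rightarrow> nat" where
  "auction_time s = slack (s ''l'') * (n + 1) + (n - s ''i'' 0)"

definition auction_state :: "state \<Rightarrow> bool" where
  "auction_state s \<longleftrightarrow> input_kept s \<and> auction_inv (s ''a'') (s ''l'') (s ''w'') \<and>
     s ''i'' 0 \<le> n \<and> s ''o'' 0 = s ''i'' 0 * m \<and> (\<forall>j < s ''i'' 0. settled s j)"

text \<open>With \<open>i\<close> reset to \<open>0\<close>, the claim about settled agents is
  vacuous, so only the auction invariant has to be restored.\<close>

lemma runs_bid:
  assumes s: "auction_state s" and i: "s ''i'' 0 < n" "s ''a'' (s ''i'' 0) = 0"
    and b: "likes (s ''i'' 0) (s ''b'' 0)" "s ''l'' (s ''b'' 0) = s ''d'' 0" "s ''d'' 0 < m + 2"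
    and min: "\<And>h. likes (s ''i'' 0) h \<Longrightarrow> s ''d'' 0 \<le> s ''l'' h"
  shows "runs bid s 80 (\<lambda>s'. auction_state s' \<and> auction_time s' < auction_time s)"
proof -
  have bm: "s ''b'' 0 < m" using b(1) by (simp add: likes_def)
  have "s ''n'' 0 = n" "s ''m'' 0 = m" and inv: "auction_inv (s ''a'') (s ''l'') (s ''w'')"
    using s by (auto simp: auction_state_def input_kept_def)
  note st = this(1,2)
  have step: "if s ''d'' 0 < m + 1
    then auction_inv (((s ''a'')(n - s ''w'' (s ''b'' 0) := 0))(s ''i'' 0 := Suc (s ''b'' 0)))
      ((s ''l'')(s ''b'' 0 := Suc (s ''d'' 0))) ((s ''w'')(s ''b'' 0 := n - s ''i'' 0))
    else auction_inv ((s ''a'')(n - s ''w'' (s ''b'' 0) := 0))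
      ((s ''l'')(s ''b'' 0 := Suc (s ''d'' 0))) (s ''w'')"
    using auction_inv_bid[OF inv i(2) b(1), unfolded b(2)] min b(3) by simp
  have "slack ((s ''l'')(s ''b'' 0 := Suc (s ''d'' 0))) < slack (s ''l'')"
    using slack_bid[OF bm, of "s ''l''"] b by simp
  \<comment> \<open>One unit of slack is worth \<open>n + 1\<close>, more than the at most
    \<open>n\<close> lost by resetting \<open>i\<close>.\<close>
  then have "Suc (slack ((s ''l'')(s ''b'' 0 := Suc (s ''d'' 0)))) * (n + 1) \<le> slack (s ''l'') * (n + 1)"
    by (intro mult_le_mono1) simp
  then have time: "slack ((s ''l'')(s ''b'' 0 := Suc (s ''d'' 0))) * (n + 1) + n < auction_time s"
    unfolding auction_time_def by (simp only: mult_Suc)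
  have kept: "input_kept s" using s by (simp add: auction_state_def)
  show ?thesis
    unfolding bid_def using step time kept
    by (auto simp: auction_state_def auction_time_def input_kept_def st split: if_splits)
qed

lemma runs_auction:
  assumes "auction_state s"
  shows "runs auction s ((60 * m + 200) * auction_time s + 5)
    (\<lambda>s'. auction_state s' \<and> (\<forall>j<n. settled s' j))"
proof -
  let ?b = "Less (Scalar ''i'') (Scalar ''n'')"
  have "runs auction s ((bcost ?b + (60 * m + 20 + 120)) * auction_time s + bcost ?b)
    (\<lambda>s'. auction_state s' \<and> \<not> bval ?b s')"
    unfolding auction_def using assms
  proof (rule runs_While[where I = auction_state and \<mu> = auction_time])
    fix s assume s: "auction_state s" and "bval ?b s"
    then have st: "s ''n'' 0 = n" "s ''m'' 0 = m" "s ''o'' 0 = s ''i'' 0 * m" "input_kept s"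
      and i: "s ''i'' 0 < n"
      by (auto simp: auction_state_def input_kept_def)
    show "runs serve_agent s (60 * m + 20 + 120)
      (\<lambda>s'. auction_state s' \<and> auction_time s' < auction_time s)"
      unfolding serve_agent_def
    proof (rule runs_Seq[OF runs_cheapest_house[OF st(4,3) i]], elim conjE)
      fix s' assume eq: "\<forall>x. x \<notin> {''b'', ''d'', ''h''} \<longrightarrow> s' x = s x"
        and min: "\<forall>h. likes (s ''i'' 0) h \<longrightarrow> s' ''d'' 0 \<le> s ''l'' h \<or> m + 2 \<le> s ''l'' h"
        and b: "s' ''d'' 0 < m + 2 \<longrightarrow>
          likes (s ''i'' 0) (s' ''b'' 0) \<and> s ''l'' (s' ''b'' 0) = s' ''d'' 0"
        and d: "s' ''d'' 0 \<le> m + 2"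
      have eqs: "s' ''a'' = s ''a''" "s' ''l'' = s ''l''" "s' ''w'' = s ''w''" "s' ''i'' = s ''i''"
        "s' ''o'' = s ''o''" "s' ''n'' = s ''n''" "s' ''m'' = s ''m''" "s' ''v'' = s ''v''"
        using eq by simp_all
      have s': "auction_state s'" and time: "auction_time s' = auction_time s"
        using s by (simp_all add: auction_state_def auction_time_def input_kept_def settled_def eqs)
      have next_agent: "auction_state (s'(''i'' := (s' ''i'')(0 := Suc (s ''i'' 0)),
            ''o'' := (s' ''o'')(0 := s ''i'' 0 * m + m))) \<and>
          auction_time (s'(''i'' := (s' ''i'')(0 := Suc (s ''i'' 0)),
            ''o'' := (s' ''o'')(0 := s ''i'' 0 * m + m))) < auction_time s"
        if "settled s (s ''i'' 0)"
      proof -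
        have "settled s j" if "j < Suc (s ''i'' 0)" for j
          using that s \<open>settled s (s ''i'' 0)\<close> unfolding auction_state_def less_Suc_eq by blast
        moreover have "n - Suc (s ''i'' 0) < n - s ''i'' 0" using i by simp
        ultimately show ?thesis
          using s i
          by (simp add: auction_state_def auction_time_def input_kept_def settled_def eqs)
      qed
      show "runs (If (Conj (Less (Scalar ''d'') (Add (Scalar ''m'') (Num 2)))
                  (Neg (Less (Num 0) (Read ''a'' (Scalar ''i'')))))
          bid
          (Seq (Assign ''i'' (Add (Scalar ''i'') (Num 1)))
               (Assign ''o'' (Add (Scalar ''o'') (Scalar ''m''))))) s' 120
        (\<lambda>s'. auction_state s' \<and> auction_time s' < auction_time s)"
      proof (cases "s' ''d'' 0 < m + 2 \<and> s ''a'' (s ''i'' 0) = 0")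
        case True
        have "runs bid s' 80 (\<lambda>s''. auction_state s'' \<and> auction_time s'' < auction_time s')"
          using True i b min by (intro runs_bid[OF s']) (auto simp: eqs)
        \<comment> \<open>The test costs \<open>14\<close>, which leaves \<open>106\<close> of the
          budget \<open>120\<close>.\<close>
        then have "runs bid s' 106 (\<lambda>s''. auction_state s'' \<and> auction_time s'' < auction_time s)"
          by (rule runs_mono) (simp_all add: time)
        then show ?thesis using True by (simp add: eqs st)
      next
        case False
        then have "s' ''d'' 0 = m + 2 \<or> 0 < s ''a'' (s ''i'' 0)" using d by auto
        \<comment> \<open>If \<open>d = m + 2\<close>, the search has shown that every house the
          agent likes is withdrawn.\<close>
        then have "settled s (s ''i'' 0)" using min unfolding settled_def by metis
        then show ?thesis using next_agent False by (auto simp: eqs st)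
      qed
    qed
  qed
  then show ?thesis
  proof (rule runs_mono)
    show "(bcost ?b + (60 * m + 20 + 120)) * auction_time s + bcost ?b
        \<le> (60 * m + 200) * auction_time s + 5"
      using mult_le_mono1[of "bcost ?b + (60 * m + 20 + 120)" "60 * m + 200" "auction_time s"] by simp
    show "auction_state s' \<and> (\<forall>j<n. settled s' j)" if "auction_state s' \<and> \<not> bval ?b s'" for s'
      using that by (simp add: auction_state_def input_kept_def)
  qed
qed

section \<open>Giving free houses to unmatched agents\<close>

definition fill_inv :: "(nat \<Rightarrow> nat) \<Rightarrow> (nat \<Rightarrow> nat) \<Rightarrow> (nat \<Rightarrow> nat) \<Rightarrow> nat \<Rightarrow> nat \<Rightarrow> bool" where
  "fill_inv a0 l a i h \<longleftrightarrow> i \<le> n \<and> h \<le> m \<and>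
     (\<forall>j<n. 0 < a0 j \<or> i \<le> j \<longrightarrow> a j = a0 j) \<and>
     (\<forall>j<i. 0 < a j) \<and>
     (\<forall>j<n. \<forall>k. a0 j = 0 \<longrightarrow> a j = Suc k \<longrightarrow> k < h \<and> l k = 0) \<and>
     (\<forall>j<n. \<forall>j'<n. 0 < a j \<longrightarrow> a j = a j' \<longrightarrow> j = j') \<and>
     (\<forall>k<h. l k = 0 \<longrightarrow> (\<exists>j<n. a j = Suc k))"

text \<open>House \<open>h\<close> is still free: agents served during the filling hold houses below
  \<open>h\<close>, and agents matched by the auction, recorded in \<open>a0\<close>, hold houses of
  positive label.\<close>

lemma fill_inv_assign:
  assumes "fill_inv a0 l a i h" "\<And>j k. j < n \<Longrightarrow> a0 j = Suc k \<Longrightarrow> 0 < l k"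
    and "i < n" "h < m" "a i = 0" "l h = 0"
  shows "fill_inv a0 l (a(i := Suc h)) (Suc i) (Suc h)"
proof -
  have new: "a j \<noteq> Suc h" if "j < n" for j
  proof
    assume j: "a j = Suc h"
    show False
    proof (cases "a0 j = 0")
      case True
      then show False using assms(1) j that unfolding fill_inv_def by blast
    next
      case False
      then have "a0 j = Suc h" using assms(1) j that unfolding fill_inv_def by auto
      then show False using assms(2)[OF that] assms(6) by fastforce
    qed
  qed
  \<comment> \<open>Cells from \<open>i\<close> onwards are still as the auction left them.\<close>
  have "a0 i = 0" using assms(1,3,5) unfolding fill_inv_def by auto
  have *: "i \<le> n" "h \<le> m" "\<And>j. j < n \<Longrightarrow> 0 < a0 j \<or> i \<le> j \<Longrightarrow> a j = a0 j"
     "\<And>j. j<i \<Longrightarrow> 0 < a j"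
     "\<And>j k. j<n \<Longrightarrow> a0 j = 0 \<Longrightarrow> a j = Suc k \<Longrightarrow> k < h \<and> l k = 0"
     "\<And>j j'. j<n \<Longrightarrow> j'<n \<Longrightarrow> 0 < a j \<Longrightarrow> a j = a j' \<Longrightarrow> j = j'"
     "\<And>k. k<h \<Longrightarrow> l k = 0 \<Longrightarrow> \<exists>j<n. a j = Suc k"
    using assms(1) unfolding fill_inv_def by blast+
  show ?thesis
    unfolding fill_inv_def
  proof (intro conjI allI impI)
    show "Suc i \<le> n" "Suc h \<le> m" using assms by simp_all
  next
    fix j assume "j < n" "0 < a0 j \<or> Suc i \<le> j"
    then show "(a(i := Suc h)) j = a0 j" using *(3)[of j] \<open>a0 i = 0\<close> by auto
  next
    fix j assume "j < Suc i"
    then show "0 < (a(i := Suc h)) j" using *(4)[of j] by auto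
  next
    fix j k assume "j < n" "a0 j = 0" "(a(i := Suc h)) j = Suc k"
    then show "k < Suc h" "l k = 0" using *(5)[of j k] assms(6) by (auto split: if_splits)
  next
    fix j j' assume "j < n" "j' < n" "0 < (a(i := Suc h)) j" "(a(i := Suc h)) j = (a(i := Suc h)) j'"
    then show "j = j'" using *(6)[of j j'] new[of j] new[of j'] by (auto split: if_splits)
  next
    fix k assume "k < Suc h" "l k = 0"
    then show "\<exists>j<n. (a(i := Suc h)) j = Suc k"
      using *(7)[of k] assms(3,5) by (cases "k = h") fastforce+
  qed
qed

text \<open>Every iteration advances the agent pointer, the house pointer or both, so there are at
  most \<open>n + m\<close> of them. Whichever pointer reaches its end, nothing more can be
  assigned.\<close>

lemma runs_fill:
  assumes s: "s ''n'' 0 = n" "s ''m'' 0 = m"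
    and l: "\<And>j k. j < n \<Longrightarrow> s ''a'' j = Suc k \<Longrightarrow> 0 < s ''l'' k"
    and inj: "\<And>j j'. j < n \<Longrightarrow> j' < n \<Longrightarrow> 0 < s ''a'' j \<Longrightarrow> s ''a'' j = s ''a'' j' \<Longrightarrow> j = j'"
  shows "runs fill s (60 * (n + m) + 20)
    (\<lambda>s'. \<exists>i h. fill_inv (s ''a'') (s ''l'') (s' ''a'') i h \<and> (i = n \<or> h = m))"
proof -
  let ?b = "Conj (Less (Scalar ''i'') (Scalar ''n'')) (Less (Scalar ''h'') (Scalar ''m''))"
  define I where "I = (\<lambda>s'. fill_inv (s ''a'') (s ''l'') (s' ''a'') (s' ''i'' 0) (s' ''h'' 0) \<and>
      s' ''n'' = s ''n'' \<and> s' ''m'' = s ''m'' \<and> s' ''l'' = s ''l'')"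
  have loop: "runs (While ?b fill_step) s' ((bcost ?b + 49) * ((n - s' ''i'' 0) + (m - s' ''h'' 0)) + bcost ?b)
      (\<lambda>s'. I s' \<and> \<not> bval ?b s')"
    if "I s'" for s'
    using that
  proof (rule runs_While[where \<mu> = "\<lambda>s'. (n - s' ''i'' 0) + (m - s' ''h'' 0)"])
    fix s' assume I: "I s'" and "bval ?b s'"
    then have ih: "s' ''i'' 0 < n" "s' ''h'' 0 < m"
      and F: "fill_inv (s ''a'') (s ''l'') (s' ''a'') (s' ''i'' 0) (s' ''h'' 0)"
      and eqs: "s' ''n'' = s ''n''" "s' ''m'' = s ''m''" "s' ''l'' = s ''l''"
      by (auto simp: I_def s)
    have 1: "fill_inv (s ''a'') (s ''l'') (s' ''a'') (Suc (s' ''i'' 0)) (s' ''h'' 0)"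
      if "0 < s' ''a'' (s' ''i'' 0)"
      using F ih that unfolding fill_inv_def by (auto simp: less_Suc_eq)
    have 2: "fill_inv (s ''a'') (s ''l'') (s' ''a'') (s' ''i'' 0) (Suc (s' ''h'' 0))"
      if "0 < s ''l'' (s' ''h'' 0)"
      using F ih that unfolding fill_inv_def by (auto simp: less_Suc_eq)
    have 3: "fill_inv (s ''a'') (s ''l'') ((s' ''a'')(s' ''i'' 0 := Suc (s' ''h'' 0)))
        (Suc (s' ''i'' 0)) (Suc (s' ''h'' 0))"
      if "s' ''a'' (s' ''i'' 0) = 0" "s ''l'' (s' ''h'' 0) = 0"
      by (rule fill_inv_assign[OF F _ ih that]) (rule l)
    show "runs fill_step s' 49 (\<lambda>s''. I s'' \<and>
        (n - s'' ''i'' 0) + (m - s'' ''h'' 0) < (n - s' ''i'' 0) + (m - s' ''h'' 0))"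
      unfolding fill_step_def using 1 2 3 ih by (auto simp: I_def eqs)
  qed
  let ?s = "s(''i'' := (s ''i'')(0 := 0), ''h'' := (s ''h'')(0 := 0))"
  have "I ?s"
    using inj by (auto simp: I_def fill_inv_def dest: l)
  from loop[OF this]
  have "runs (While ?b fill_step) ?s (60 * (n + m) + 14) (\<lambda>s'. I s' \<and> \<not> bval ?b s')"
    by (rule runs_mono) simp_all
  then have "runs (While ?b fill_step) ?s (60 * (n + m) + 14)
    (\<lambda>s'. \<exists>i h. fill_inv (s ''a'') (s ''l'') (s' ''a'') i h \<and> (i = n \<or> h = m))"
  proof (rule runs_mono)
    fix s' assume s': "I s' \<and> \<not> bval ?b s'"
    then have "fill_inv (s ''a'') (s ''l'') (s' ''a'') (s' ''i'' 0) (s' ''h'' 0)"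
      and "s' ''i'' 0 = n \<or> s' ''h'' 0 = m"
      by (auto simp: I_def s fill_inv_def)
    then show "\<exists>i h. fill_inv (s ''a'') (s ''l'') (s' ''a'') i h \<and> (i = n \<or> h = m)" by blast
  qed simp
  then show ?thesis
    unfolding fill_def by (simp add: add.commute)
qed

section \<open>Optimality\<close>

text \<open>An agent who likes an assigned house would envy its holder unless it holds a liked house
  itself. Hence \<open>B\<close> restricted to these agents is the required matching.\<close>

lemma saturated_ran_envy_free:
  assumes "allocation {..<n} {..<m} B" "envy_free {..<n} v B"
  shows "saturated (ran B)"
proof -
  have B: "\<And>i h. B i = Some h \<Longrightarrow> i < n \<and> h < m" "inj_on B (dom B)"
    using assms(1) unfolding allocation_def by (auto intro: ranI)
  have served: "\<exists>h. B i = Some h \<and> likes i h" if "k \<in> ran B" "likes i k" for i k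
  proof -
    from that(1) obtain j where j: "B j = Some k" by (auto simp: ran_def)
    then have "bundle_value (v i) (B j) \<le> bundle_value (v i) (B i)"
      using assms(2) B that(2) unfolding envy_free_def likes_def by blast
    then have *: "1 \<le> bundle_value (v i) (B i)"
      using j that(2) by (simp add: bundle_value_def likes_def)
    then obtain h where h: "B i = Some h" by (cases "B i") (auto simp: bundle_value_def)
    have "v i h \<in> {0, 1}" using binary B(1)[OF h] by (simp add: binary_instance_def)
    then show ?thesis using h * B(1)[OF h] by (auto simp: likes_def bundle_value_def)
  qed
  have "inj_on (the \<circ> B) {i. \<exists>h\<in>ran B. likes i h}"
  proof (rule inj_onI)
    fix i j assume "i \<in> {i. \<exists>h\<in>ran B. likes i h}" "j \<in> {i. \<exists>h\<in>ran B. likes i h}"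
      and eq: "(the \<circ> B) i = (the \<circ> B) j"
    then obtain h k where hk: "B i = Some h" "B j = Some k" using served by blast
    then have "B i = B j" using eq by simp
    then show "i = j" using inj_onD[OF B(2)] hk by (metis domI)
  qed
  moreover have "(the \<circ> B) i \<in> ran B \<and> likes i ((the \<circ> B) i)" if "\<exists>h\<in>ran B. likes i h" for i
  proof -
    from that obtain h where "B i = Some h" "likes i h" using served by blast
    then show ?thesis by (simp add: ranI)
  qed
  moreover have "ran B \<subseteq> {..<m}" using B(1) by (auto simp: ran_def)
  ultimately show ?thesis unfolding saturated_def by blast
qed

text \<open>The set \<open>S\<close> of houses that are not withdrawn contains the range of every
  envy-free allocation. The output uses only houses of \<open>S\<close>, and it serves all agents or
  exhausts \<open>S\<close>, so its size cannot be exceeded.\<close>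

lemma max_size_envy_free_fill:
  assumes inv: "auction_inv a0 l w"
    and settled: "\<And>j h. j < n \<Longrightarrow> a0 j = 0 \<Longrightarrow> likes j h \<Longrightarrow> m + 2 \<le> l h"
    and fill: "fill_inv a0 l (s ''a'') i h" "i = n \<or> h = m"
  shows "max_size_envy_free {..<n} {..<m} v (output_alloc n s)"
proof -
  define S where "S = {k. k < m \<and> l k \<le> m + 1}"
  let ?A = "output_alloc n s"
  have A: "?A j = Some k \<longleftrightarrow> j < n \<and> s ''a'' j = Suc k" for j k
    by (auto simp: output_alloc_def)
  have fD: "i \<le> n" "h \<le> m"
     "\<And>j. j < n \<Longrightarrow> 0 < a0 j \<Longrightarrow> s ''a'' j = a0 j"
     "\<And>j. j < i \<Longrightarrow> 0 < s ''a'' j"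
     "\<And>j k. j < n \<Longrightarrow> a0 j = 0 \<Longrightarrow> s ''a'' j = Suc k \<Longrightarrow> k < h \<and> l k = 0"
     "\<And>j j'. j < n \<Longrightarrow> j' < n \<Longrightarrow> 0 < s ''a'' j \<Longrightarrow> s ''a'' j = s ''a'' j' \<Longrightarrow> j = j'"
     "\<And>k. k < h \<Longrightarrow> l k = 0 \<Longrightarrow> \<exists>j<n. s ''a'' j = Suc k"
    using fill(1) unfolding fill_inv_def by blast+
  have matched: "likes j k \<and> k \<in> S" if "j < n" "0 < a0 j" "s ''a'' j = Suc k" for j k
    using auction_invD[OF inv that(1), of k] fD(3)[OF that(1,2)] that
    by (auto simp: S_def likes_def)
  have ranA: "k \<in> S" if "?A j = Some k" for j k
  proof (cases "a0 j = 0")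
    case True
    then show ?thesis using fD(2) fD(5)[of j k] that by (auto simp: A S_def)
  next
    case False
    then show ?thesis using matched that by (auto simp: A)
  qed
  have domA: "dom ?A = {j. j < n \<and> 0 < s ''a'' j}"
    by (auto simp: output_alloc_def dom_def)
  have finA: "finite (dom ?A)" by (simp add: domA)
  have val: "v j k \<in> {0, 1}" if "j < n" "k < m" for j k
    using binary that by (simp add: binary_instance_def)
  have "allocation {..<n} {..<m} ?A"
    unfolding allocation_def
  proof (intro conjI)
    show "dom ?A \<subseteq> {..<n}" by (auto simp: domA)
    show "ran ?A \<subseteq> {..<m}" using ranA by (auto simp: ran_def S_def)
    show "inj_on ?A (dom ?A)"
    proof (rule inj_onI)
      fix j j' assume "j \<in> dom ?A" "j' \<in> dom ?A" "?A j = ?A j'"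
      then obtain k where "?A j = Some k" "?A j' = Some k" by auto
      then show "j = j'" using fD(6)[of j j'] by (auto simp: A)
    qed
  qed
  moreover have "envy_free {..<n} v ?A"
    unfolding envy_free_def
  proof (intro ballI)
    fix j j' assume j: "j \<in> {..<n}"
    show "bundle_value (v j) (?A j') \<le> bundle_value (v j) (?A j)"
    proof (cases "a0 j = 0")
      case True
      \<comment> \<open>An agent left unmatched by the auction likes no house of \<open>S\<close>,
        so it envies nobody, whatever it receives.\<close>
      have "bundle_value (v j) (?A j') = 0"
      proof (cases "?A j'")
        case (Some k)
        then have "k \<in> S" by (rule ranA)
        then have "\<not> likes j k" using settled[of j k] True j by (auto simp: S_def)
        then have "v j k = 0" using val[of j k] j \<open>k \<in> S\<close> by (auto simp: S_def likes_def)
        then show ?thesis using Some by (simp add: bundle_value_def)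
      qed (simp add: bundle_value_def)
      moreover have "0 \<le> bundle_value (v j) (?A j)"
      proof (cases "?A j")
        case (Some k)
        then show ?thesis using val[of j k] ranA[OF Some] j by (auto simp: bundle_value_def S_def)
      qed (simp add: bundle_value_def)
      ultimately show ?thesis by simp
    next
      case False
      then obtain k where k: "s ''a'' j = Suc k" using fD(3)[of j] j by (cases "a0 j") auto
      then have "?A j = Some k" "v j k = 1" using matched[of j k] False j by (auto simp: A likes_def)
      moreover have "bundle_value (v j) (?A j') \<le> 1"
      proof (cases "?A j'")
        case (Some k')
        then show ?thesis using val[of j k'] ranA[OF Some] j by (auto simp: bundle_value_def S_def)
      qed (simp add: bundle_value_def)
      ultimately show ?thesis by (simp add: bundle_value_def)
    qed
  qed
  moreover have "alloc_size B \<le> alloc_size ?A"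
    if B: "allocation {..<n} {..<m} B" "envy_free {..<n} v B" for B
    using fill(2)
  proof
    assume "i = n"
    then have "dom ?A = {..<n}" using fD(4) by (auto simp: domA)
    moreover have "dom B \<subseteq> {..<n}" using B(1) by (simp add: allocation_def)
    ultimately show ?thesis unfolding alloc_size_def by (metis card_mono finite_lessThan)
  next
    assume "h = m"
    have sat: "saturated (ran B)" using saturated_ran_envy_free[OF B] .
    have card_B: "card (dom B) \<le> card S"
    proof (rule card_inj_on_le[where f = "the \<circ> B"])
      have "inj_on B (dom B)" using B(1) by (simp add: allocation_def)
      then show "inj_on (the \<circ> B) (dom B)"
        by (rule comp_inj_on) (auto simp: inj_on_def)
      show "(the \<circ> B) ` dom B \<subseteq> S"
      proof
        fix k assume "k \<in> (the \<circ> B) ` dom B"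
        then have "k \<in> ran B" by (auto simp: ran_def)
        moreover have "ran B \<subseteq> {..<m}" using sat by (simp add: saturated_def)
        ultimately show "k \<in> S" using auction_inv_saturated[OF inv sat] by (auto simp: S_def)
      qed
    qed (simp add: S_def)
    \<comment> \<open>With \<open>h = m\<close>, every house of label \<open>0\<close> has been
      given out; a house of \<open>S\<close> with positive label keeps its owner from the
      auction.\<close>
    have "S \<subseteq> (the \<circ> ?A) ` dom ?A"
    proof
      fix k assume k: "k \<in> S"
      have "\<exists>j<n. s ''a'' j = Suc k"
      proof (cases "l k = 0")
        case True
        then show ?thesis using fD(7) k \<open>h = m\<close> by (simp add: S_def)
      next
        case False
        then obtain j where j: "j < n" "a0 j = Suc k"
          using auction_inv_houseD(3)[OF inv, of k] k by (auto simp: S_def)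
        then show ?thesis using fD(3)[of j] by auto
      qed
      then obtain j where "?A j = Some k" using A by blast
      then show "k \<in> (the \<circ> ?A) ` dom ?A" by force
    qed
    then have "card S \<le> card (dom ?A)" by (rule surj_card_le[OF finA])
    then show ?thesis using card_B unfolding alloc_size_def by simp
  qed
  ultimately show ?thesis unfolding max_size_envy_free_def by blast
qed

section \<open>Total running time\<close>

lemma auction_state_input_state: "auction_state (input_state n m v)"
  unfolding auction_state_def
  by (simp add: input_kept_input_state) (simp add: auction_inv_def input_state_def)

lemma auction_time_input_state: "auction_time (input_state n m v) = m * (m + 2) * (n + 1) + n"
  by (simp add: auction_time_def slack_def input_state_def)

lemma runs_auction_fill:
  "runs (Seq auction fill) (input_state n m v)
    (((60 * m + 200) * (m * (m + 2) * (n + 1) + n) + 5) + (60 * (n + m) + 20))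
    (\<lambda>s. max_size_envy_free {..<n} {..<m} v (output_alloc n s))"
proof (rule runs_Seq[OF runs_auction[OF auction_state_input_state, unfolded auction_time_input_state]])
  fix s assume s: "auction_state s \<and> (\<forall>j<n. settled s j)"
  then have nm: "s ''n'' 0 = n" "s ''m'' 0 = m" and inv: "auction_inv (s ''a'') (s ''l'') (s ''w'')"
    by (simp_all add: auction_state_def input_kept_def)
  have dead: "m + 2 \<le> s ''l'' h" if "j < n" "s ''a'' j = 0" "likes j h" for j h
    using s that unfolding settled_def by force
  have owners: "j = j'" if j: "j < n" "j' < n" "0 < s ''a'' j" "s ''a'' j = s ''a'' j'" for j j'
  proof -
    from j(3) obtain k where "s ''a'' j = Suc k" by (auto simp: gr0_conv_Suc)
    \<comment> \<open>Both agents own house \<open>k\<close>, and \<open>w k\<close> records its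
      owner.\<close>
    then have "n - j = n - j'" using auction_invD(4)[OF inv, of _ k] j by metis
    then show ?thesis using j by simp
  qed
  show "runs fill s (60 * (n + m) + 20)
    (\<lambda>s. max_size_envy_free {..<n} {..<m} v (output_alloc n s))"
  proof (rule runs_mono[OF runs_fill[of s]])
    fix s' assume "\<exists>i h. fill_inv (s ''a'') (s ''l'') (s' ''a'') i h \<and> (i = n \<or> h = m)"
    then obtain i h where "fill_inv (s ''a'') (s ''l'') (s' ''a'') i h" "i = n \<or> h = m" by blast
    then show "max_size_envy_free {..<n} {..<m} v (output_alloc n s')"
      by (rule max_size_envy_free_fill[OF inv, rotated]) (rule dead)
  qed (blast intro: nm owners auction_invD(2)[OF inv] order_refl)+
qed

end

theorem proposition5:
  "\<exists>(c :: com) (p :: nat poly). \<forall>(n :: nat) (m :: nat) (v :: nat \<Rightarrow> nat \<Rightarrow> real).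
     binary_instance {..<n} {..<m} v \<longrightarrow>
     (\<exists>t s. exec c (input_state n m v) t s \<and> t \<le> poly p (n + m) \<and>
            max_size_envy_free {..<n} {..<m} v (output_alloc n s))"
proof -
  define X :: "nat poly" where "X = [:0, 1:]"
  have X: "poly X N = N" for N by (simp add: X_def)
  \<comment> \<open>This is the time bound with \<open>n\<close> and \<open>m\<close> both replaced
    by \<open>n + m\<close>, which can only increase it.\<close>
  define p where "p = (60 * X + 200) * (X * (X + 2) * (X + 1) + X) + 5 + (60 * X + 20)"
  have poly_p: "poly p N = (60 * N + 200) * (N * (N + 2) * (N + 1) + N) + 5 + (60 * N + 20)" for N
    by (simp add: p_def X)
  have "\<exists>t s. exec (Seq auction fill) (input_state n m v) t s \<and> t \<le> poly p (n + m) \<and>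
      max_size_envy_free {..<n} {..<m} v (output_alloc n s)"
    if "binary_instance {..<n} {..<m} v" for n m v
  proof -
    interpret binary_houses n m v by standard (fact that)
    let ?N = "n + m"
    have "m * (m + 2) * (n + 1) + n \<le> ?N * (?N + 2) * (?N + 1) + ?N"
      by (rule add_mono[OF mult_le_mono[OF mult_le_mono]]) simp_all
    then have "(60 * m + 200) * (m * (m + 2) * (n + 1) + n)
        \<le> (60 * ?N + 200) * (?N * (?N + 2) * (?N + 1) + ?N)"
      by (rule mult_le_mono[rotated]) simp
    then have "(60 * m + 200) * (m * (m + 2) * (n + 1) + n) + 5 + (60 * ?N + 20) \<le> poly p ?N"
      by (simp only: poly_p add_le_cancel_right)
    then have "runs (Seq auction fill) (input_state n m v) (poly p ?N)
        (\<lambda>s. max_size_envy_free {..<n} {..<m} v (output_alloc n s))"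
      by (rule runs_mono[OF runs_auction_fill])
    then show ?thesis unfolding runs_def .
  qed
  then show ?thesis by blast
qed

end
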